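(* Let $\alpha,\beta$ be relatively prime positive integers. For $A,B\in\{E,N\}$ let $f_{ab}(x)=\sum_{k\ge1}a_kx^k$, where $a_k$ is the number of $AB$-paths in $\mathcal{L}_{\beta/\alpha}(k)$ that are bounce-free with respect to the line $y=\frac{\beta}{\alpha}x$. Then, as formal power series, $$f_{ee}(x)=\frac{g_{ee}(x)}{(1+g_{en}(x))^2-g_{ee}(x)g_{nn}(x)},\qquad f_{nn}(x)=\frac{g_{nn}(x)}{(1+g_{en}(x))^2-g_{ee}(x)g_{nn}(x)},$$ $$f_{en}(x)=1-\frac{1+g_{en}(x)}{(1+g_{en}(x))^2-g_{ee}(x)g_{nn}(x)}.$$
   Context: For a positive integer $k$, $\mathcal{L}_{\beta/\alpha}(k)$ is the set of lattice paths from $(0,0)$ to $(\alpha k,\beta k)$ with unit East steps $E=(1,0)$ and unit North steps $N=(0,1)$. For $A,B\in\{E,N\}$, an $AB$-path is such a path whose first step is $A$ and whose last step is $B$. A left bounce of a path is an interior vertex of the path that lies on the line $y=\frac{\beta}{\alpha}x$ (hence is a point $(\alpha i,\beta i)$ with $0<i<k$) at which the path arrives by an $E$-step and leaves by an $N$-step; a right bounce is such a vertex at which the path arrives by an $N$-step and leaves by an $E$-step. A path is bounce-free if it has no left bounces and no right bounces. $g_{ab}(x)$ is the generating function (in $x^k$, $k\ge1$) for the number of all $AB$-paths in $\mathcal{L}_{\beta/\alpha}(k)$: $g_{ee}(x)=\sum_{k\ge1}\binom{(\alpha+\beta)k-2}{\alpha k-2}x^k$, $g_{en}(x)=g_{ne}(x)=\sum_{k\ge1}\binom{(\alpha+\beta)k-2}{\alpha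 k-1}x^k$, $g_{nn}(x)=\sum_{k\ge1}\binom{(\alpha+\beta)k-2}{\alpha k}x^k$, with $\binom{n}{m}=0$ if $m<0$ or $m>n$. *)

theory Defs
  imports "HOL-Computational_Algebra.Formal_Power_Series"
begin

datatype step = E | N

definition vertex :: "step list \<Rightarrow> nat \<Rightarrow> nat \<times> nat" where
  "vertex p i = (count_list (take i p) E, count_list (take i p) N)"

definition lattice_paths :: "nat \<Rightarrow> nat \<Rightarrow> nat \<Rightarrow> step list set" where
  "lattice_paths \<alpha> \<beta> k = {p. vertex p (length p) = (\<alpha> * k, \<beta> * k)}"

definition AB_paths :: "nat \<Rightarrow> nat \<Rightarrow> step \<Rightarrow> step \<Rightarrow> nat \<Rightarrow> step list set" where
  "AB_paths \<alpha> \<beta> A B k = {p \<in> lattice_paths \<alpha> \<beta> k. p \<noteq> [] \<and> hd p = A \<and> last p = B}"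

definition on_line :: "nat \<Rightarrow> nat \<Rightarrow> nat \<times> nat \<Rightarrow> bool" where
  "on_line \<alpha> \<beta> = (\<lambda>(x, y). (of_nat y :: rat) = of_nat \<beta> / of_nat \<alpha> * of_nat x)"

text \<open>Bounces are located by the index \<open>i\<close> of the vertex: \<open>p ! (i - 1)\<close> is the step arriving at
  \<open>vertex p i\<close> and \<open>p ! i\<close> is the step leaving it.\<close>

definition left_bounce :: "nat \<Rightarrow> nat \<Rightarrow> step list \<Rightarrow> nat \<Rightarrow> bool" where
  "left_bounce \<alpha> \<beta> p i \<longleftrightarrow> 0 < i \<and> i < length p \<and> on_line \<alpha> \<beta> (vertex p i) \<and>
     p ! (i - 1) = E \<and> p ! i = N"

definition right_bounce :: "nat \<Rightarrow> nat \<Rightarrow> step list \<Rightarrow> nat \<Rightarrow> bool" where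
  "right_bounce \<alpha> \<beta> p i \<longleftrightarrow> 0 < i \<and> i < length p \<and> on_line \<alpha> \<beta> (vertex p i) \<and>
     p ! (i - 1) = N \<and> p ! i = E"

definition bounce_free :: "nat \<Rightarrow> nat \<Rightarrow> step list \<Rightarrow> bool" where
  "bounce_free \<alpha> \<beta> p \<longleftrightarrow> (\<forall>i. \<not> left_bounce \<alpha> \<beta> p i \<and> \<not> right_bounce \<alpha> \<beta> p i)"

text \<open>The coefficients are natural numbers; they are embedded into \<^typ>\<open>rat\<close> so that division of
  formal power series is available.\<close>

definition path_gf :: "nat \<Rightarrow> nat \<Rightarrow> step \<Rightarrow> step \<Rightarrow> rat fps" where
  "path_gf \<alpha> \<beta> A B =
     Abs_fps (\<lambda>k. if k = 0 then 0 else of_nat (card (AB_paths \<alpha> \<beta> A B k)))"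

definition bounce_free_gf :: "nat \<Rightarrow> nat \<Rightarrow> step \<Rightarrow> step \<Rightarrow> rat fps" where
  "bounce_free_gf \<alpha> \<beta> A B =
     Abs_fps (\<lambda>k. if k = 0 then 0
       else of_nat (card {p \<in> AB_paths \<alpha> \<beta> A B k. bounce_free \<alpha> \<beta> p}))"


subsection \<open>Closed forms of the generating functions of all paths\<close>

lemma length_count_step: "length p = count_list p E + count_list p N"
proof (induction p)
  case (Cons s p)
  then show ?case by (cases s) auto
qed simp

lemma finite_step_lists: "finite {p. count_list p E = a \<and> count_list p N = b}"
proof (rule finite_subset)
  have "UNIV = {E, N}" using step.exhaust by auto
  then have "finite (UNIV :: step set)" by (metis finite.emptyI finite_insert)
  then show "finite {p :: step list. set p \<subseteq> UNIV \<and> length p = a + b}"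
    by (rule finite_lists_length_eq)
qed (auto simp: length_count_step)

lemma finite_AB_paths: "finite (AB_paths \<alpha> \<beta> A B k)"
  by (rule finite_subset[OF _ finite_step_lists[of "\<alpha> * k" "\<beta> * k"]])
     (auto simp: AB_paths_def lattice_paths_def vertex_def)

lemma card_step_lists:
  "card {p. count_list p E = a \<and> count_list p N = b} = (a + b) choose a"
proof (induction "a + b" arbitrary: a b)
  case 0
  then have "{p. count_list p E = a \<and> count_list p N = b} = {[]}"
    using length_count_step by (auto simp flip: length_0_conv)
  then show ?case using 0 by simp
next
  case (Suc n)
  let ?S = "\<lambda>a b. {p. count_list p E = a \<and> count_list p N = b}"
  show ?case
  proof (cases a)
    case 0
    then obtain b' where b: "b = Suc b'" using Suc(2) by (cases b) auto
    have "?S a b = Cons N ` ?S a b'"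
    proof (intro equalityI subsetI)
      fix p assume p: "p \<in> ?S a b"
      then show "p \<in> Cons N ` ?S a b'"
      proof (cases p)
        case (Cons s q)
        then show ?thesis using p 0 b by (cases s) auto
      qed (use b in auto)
    qed (use b in auto)
    then have "card (?S a b) = card (?S a b')" by (simp add: card_image)
    then show ?thesis using Suc(1)[of a b'] Suc(2) 0 b by simp
  next
    case a: (Suc a')
    show ?thesis
    proof (cases b)
      case 0
      have "?S a b = Cons E ` ?S a' b"
      proof (intro equalityI subsetI)
        fix p assume p: "p \<in> ?S a b"
        then show "p \<in> Cons E ` ?S a' b"
        proof (cases p)
          case (Cons s q)
          then show ?thesis using p 0 a by (cases s) auto
        qed (use a in auto)
      qed (use a in auto)
      then have "card (?S a b) = card (?S a' b)" by (simp add: card_image)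
      then show ?thesis using Suc(1)[of a' b] Suc(2) 0 a by simp
    next
      case b: (Suc b')
      have "?S a b = Cons E ` ?S a' b \<union> Cons N ` ?S a b'"
      proof (intro equalityI subsetI)
        fix p assume p: "p \<in> ?S a b"
        then show "p \<in> Cons E ` ?S a' b \<union> Cons N ` ?S a b'"
        proof (cases p)
          case (Cons s q)
          then show ?thesis using p a b by (cases s) auto
        qed (use a in auto)
      qed (use a b in auto)
      then have "card (?S a b) = card (Cons E ` ?S a' b) + card (Cons N ` ?S a b')"
        by (simp only:) (rule card_Un_disjoint; auto simp: finite_step_lists)
      also have "\<dots> = card (?S a' b) + card (?S a b')" by (simp add: card_image)
      also have "\<dots> = (a' + b choose a') + (a + b' choose a)"
        using Suc(1)[of a' b] Suc(1)[of a b'] Suc(2) a b by simp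
      also have "\<dots> = (a + b choose a)" using a b by simp
      finally show ?thesis .
    qed
  qed
qed

lemma card_AB_paths:
  fixes A B :: step
  defines "e \<equiv> (if A = E then 1 else 0) + (if B = E then 1 else 0)"
  assumes k: "k > 0" and pos: "\<alpha> > 0" "\<beta> > 0"
  shows "card (AB_paths \<alpha> \<beta> A B k) =
    (if \<alpha> * k < e then 0 else ((\<alpha> + \<beta>) * k - 2) choose (\<alpha> * k - e))"
proof -
  let ?S = "{q. count_list q E + e = \<alpha> * k \<and> count_list q N + (2 - e) = \<beta> * k}"
  have ge: "\<alpha> * k \<ge> 1" "\<beta> * k \<ge> 1" using k pos by (auto simp: Suc_le_eq)
  have eq: "AB_paths \<alpha> \<beta> A B k = (\<lambda>q. A # q @ [B]) ` ?S"
  proof (intro equalityI subsetI)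
    fix p assume "p \<in> AB_paths \<alpha> \<beta> A B k"
    then have p: "count_list p E = \<alpha> * k" "count_list p N = \<beta> * k" "p \<noteq> []" "hd p = A" "last p = B"
      by (auto simp: AB_paths_def lattice_paths_def vertex_def)
    then have len: "length p \<ge> 2" using length_count_step[of p] ge by linarith
    obtain r where r: "p = A # r" using p by (cases p) auto
    with len have "r \<noteq> []" by auto
    then obtain q where q: "p = A # q @ [B]"
      using r p by (metis append_butlast_last_id last_ConsR)
    then have "q \<in> ?S" using p by (cases A; cases B) (auto simp: e_def)
    then show "p \<in> (\<lambda>q. A # q @ [B]) ` ?S" using q by blast
  next
    fix p assume "p \<in> (\<lambda>q. A # q @ [B]) ` ?S"
    then show "p \<in> AB_paths \<alpha> \<beta> A B k"
      by (cases A; cases B) (auto simp: AB_paths_def lattice_paths_def vertex_def e_def)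
  qed
  have card: "card (AB_paths \<alpha> \<beta> A B k) = card ?S"
    unfolding eq by (rule card_image) (auto simp: inj_on_def)
  have sum: "(\<alpha> + \<beta>) * k = \<alpha> * k + \<beta> * k" by (simp add: algebra_simps)
  have e2: "e \<le> 2" by (simp add: e_def)
  show ?thesis
  proof (cases "\<alpha> * k < e \<or> \<beta> * k < 2 - e")
    case True
    then have S: "?S = {}" by auto
    have "card (AB_paths \<alpha> \<beta> A B k) = 0" unfolding card S by simp
    moreover have "\<alpha> * k + \<beta> * k - 2 < \<alpha> * k - e" if "\<not> \<alpha> * k < e"
      using that True ge e2 by linarith
    ultimately show ?thesis unfolding sum by simp
  next
    case False
    then have "?S = {q. count_list q E = \<alpha> * k - e \<and> count_list q N = \<beta> * k - (2 - e)}" by auto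
    moreover have "(\<alpha> * k - e) + (\<beta> * k - (2 - e)) = (\<alpha> + \<beta>) * k - 2"
      using False e2 unfolding sum by auto
    ultimately show ?thesis using False unfolding card
      by (simp add: card_step_lists)
  qed
qed

lemma
  assumes "\<alpha> > 0" "\<beta> > 0"
  shows path_gf_EE: "path_gf \<alpha> \<beta> E E = Abs_fps (\<lambda>k. if k = 0 \<or> \<alpha> * k < 2 then 0
            else of_nat (((\<alpha> + \<beta>) * k - 2) choose (\<alpha> * k - 2)))"
    and path_gf_EN: "path_gf \<alpha> \<beta> E N = Abs_fps (\<lambda>k. if k = 0 then 0
            else of_nat (((\<alpha> + \<beta>) * k - 2) choose (\<alpha> * k - 1)))"
    and path_gf_NE: "path_gf \<alpha> \<beta> N E = path_gf \<alpha> \<beta> E N"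
    and path_gf_NN: "path_gf \<alpha> \<beta> N N = Abs_fps (\<lambda>k. if k = 0 then 0
            else of_nat (((\<alpha> + \<beta>) * k - 2) choose (\<alpha> * k)))"
  using assms by (auto simp: path_gf_def card_AB_paths fps_eq_iff numeral_2_eq_2)

end

(* Cutting a path with a bounce at its first bounce gives a bounce-free AC-path followed by an
   arbitrary C'B-path, where C' is the step other than C; coprimality forces the cut point to be
   (\<alpha> i, \<beta> i). Hence g_ab = f_ab + f_ae g_nb + f_an g_eb, and for each fixed a this is a linear
   system in f_ae, f_an, which Cramer's rule solves. *)

theory Submission
  imports Defs
begin

definition other_step :: "step \<Rightarrow> step" where
  "other_step A = (if A = E then N else E)"

lemma other_step_simps [simp]: "other_step E = N" "other_step N = E"
  by (simp_all add: other_step_def)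

text \<open>Treating left and right bounces alike makes the first bounce of either kind a single
  least index.\<close>

definition bounce :: "nat \<Rightarrow> nat \<Rightarrow> step list \<Rightarrow> nat \<Rightarrow> bool" where
  "bounce \<alpha> \<beta> p i \<longleftrightarrow>
     0 < i \<and> i < length p \<and> on_line \<alpha> \<beta> (vertex p i) \<and> p ! i = other_step (p ! (i - 1))"

lemma bounce_free_iff: "bounce_free \<alpha> \<beta> p \<longleftrightarrow> (\<forall>i. \<not> bounce \<alpha> \<beta> p i)"
proof -
  have "bounce \<alpha> \<beta> p i \<longleftrightarrow> left_bounce \<alpha> \<beta> p i \<or> right_bounce \<alpha> \<beta> p i" for i
    by (cases "p ! (i - 1)") (auto simp: bounce_def left_bounce_def right_bounce_def)
  then show ?thesis by (simp add: bounce_free_def)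
qed

text \<open>A bounce at \<open>i\<close> depends only on the steps up to index \<open>i\<close>, all
  of which lie in \<open>q\<close>.\<close>

lemma bounce_append:
  assumes "i < length q"
  shows "bounce \<alpha> \<beta> (q @ r) i \<longleftrightarrow> bounce \<alpha> \<beta> q i"
  using assms by (auto simp: bounce_def vertex_def nth_append)

definition bounce_free_paths :: "nat \<Rightarrow> nat \<Rightarrow> step \<Rightarrow> step \<Rightarrow> nat \<Rightarrow> step list set" where
  "bounce_free_paths \<alpha> \<beta> A B k = {p \<in> AB_paths \<alpha> \<beta> A B k. bounce_free \<alpha> \<beta> p}"

lemma AB_paths_iff:
  "p \<in> AB_paths \<alpha> \<beta> A B k \<longleftrightarrow>
     count_list p E = \<alpha> * k \<and> count_list p N = \<beta> * k \<and> p \<noteq> [] \<and> hd p = A \<and> last p = B"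
  by (auto simp: AB_paths_def lattice_paths_def vertex_def)

text \<open>Lets the coefficient lemmas below absorb the case \<open>k = 0\<close> of the generating
  functions.\<close>

lemma AB_paths_0 [simp]: "AB_paths \<alpha> \<beta> A B 0 = {}"
proof -
  have "p = []" if "count_list p E = 0" "count_list p N = 0" for p
    using length_count_step[of p] that by simp
  then show ?thesis by (auto simp: AB_paths_iff)
qed

lemma path_gf_nth [simp]: "fps_nth (path_gf \<alpha> \<beta> A B) k = of_nat (card (AB_paths \<alpha> \<beta> A B k))"
  by (simp add: path_gf_def)

lemma bounce_free_gf_nth [simp]:
  "fps_nth (bounce_free_gf \<alpha> \<beta> A B) k = of_nat (card (bounce_free_paths \<alpha> \<beta> A B k))"
  by (simp add: bounce_free_gf_def bounce_free_paths_def)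

lemma finite_bounce_free_paths: "finite (bounce_free_paths \<alpha> \<beta> A B k)"
  by (simp add: bounce_free_paths_def finite_AB_paths)

text \<open>Clearing the denominator gives \<open>\<alpha> * y = \<beta> * x\<close>, and
  coprimality then makes \<alpha> divide \<open>x\<close>. Thus the part of a path before a bounce
  is again a path of the same slope.\<close>

lemma on_line_iff:
  assumes "\<alpha> > 0" "coprime \<alpha> \<beta>"
  shows "on_line \<alpha> \<beta> v \<longleftrightarrow> (\<exists>i. v = (\<alpha> * i, \<beta> * i))"
proof
  assume "on_line \<alpha> \<beta> v"
  moreover obtain x y where v: "v = (x, y)" by fastforce
  ultimately have "(of_nat (\<alpha> * y) :: rat) = of_nat (\<beta> * x)"
    using assms(1) by (simp add: on_line_def field_simps)
  then have eq: "\<alpha> * y = \<beta> * x" by (simp only: of_nat_eq_iff)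
  then have "\<alpha> dvd \<beta> * x" by (metis dvd_triv_left)
  then obtain i where "x = \<alpha> * i" using assms(2) by (auto simp: coprime_dvd_mult_right_iff)
  with eq assms(1) have "y = \<beta> * i" by simp
  with \<open>x = \<alpha> * i\<close> v show "\<exists>i. v = (\<alpha> * i, \<beta> * i)" by blast
qed (use assms(1) in \<open>auto simp: on_line_def\<close>)

lemma append_AB_paths:
  assumes "q \<in> AB_paths \<alpha> \<beta> A C i" "r \<in> AB_paths \<alpha> \<beta> D B j"
  shows "q @ r \<in> AB_paths \<alpha> \<beta> A B (i + j)"
  using assms by (auto simp: AB_paths_iff algebra_simps)

text \<open>The junction \<open>(\<alpha> * i, \<beta> * i)\<close> lies on the line, is entered by
  \<open>C\<close> and left by the other step.\<close>

lemma bounce_append_AB_paths: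
  assumes "\<alpha> > 0" "q \<in> AB_paths \<alpha> \<beta> A C i" "r \<in> AB_paths \<alpha> \<beta> (other_step C) B j"
  shows "bounce \<alpha> \<beta> (q @ r) (length q)"
  using assms
  by (auto simp: bounce_def AB_paths_iff vertex_def nth_append on_line_def last_conv_nth hd_conv_nth)

lemma split_at_first_bounce:
  assumes "\<alpha> > 0" "coprime \<alpha> \<beta>"
    and p: "p \<in> AB_paths \<alpha> \<beta> A B k" and nf: "\<not> bounce_free \<alpha> \<beta> p"
  obtains C i q r where "i \<le> k" "p = q @ r" "q \<in> bounce_free_paths \<alpha> \<beta> A C i"
    "r \<in> AB_paths \<alpha> \<beta> (other_step C) B (k - i)"
proof -
  \<comment> \<open>Minimality of \<open>n\<close> is what makes the initial piece
    \<open>take n p\<close> bounce-free.\<close>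
  define n where "n = (LEAST n. bounce \<alpha> \<beta> p n)"
  have n: "bounce \<alpha> \<beta> p n" and least: "\<And>m. m < n \<Longrightarrow> \<not> bounce \<alpha> \<beta> p m"
    using nf LeastI_ex[of "bounce \<alpha> \<beta> p"] not_less_Least
    unfolding n_def bounce_free_iff by blast+
  define q r where "q = take n p" and "r = drop n p"
  have pqr: "p = q @ r" and len: "length q = n" and ne: "q \<noteq> []" "r \<noteq> []"
    using n by (auto simp: q_def r_def bounce_def)
  have last: "last q = p ! (n - 1)" and hd: "hd r = p ! n"
    using ne len by (auto simp: pqr nth_append last_conv_nth hd_conv_nth)
  obtain i where "vertex p n = (\<alpha> * i, \<beta> * i)"
    using n on_line_iff[OF assms(1,2)] by (auto simp: bounce_def)
  then have i: "count_list q E = \<alpha> * i" "count_list q N = \<beta> * i"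
    by (auto simp: vertex_def q_def)
  have k: "\<alpha> * i + count_list r E = \<alpha> * k" "\<beta> * i + count_list r N = \<beta> * k"
    using p i by (auto simp: AB_paths_iff pqr)
  then have "\<alpha> * i \<le> \<alpha> * k" by linarith
  then have ik: "i \<le> k" using assms(1) by simp
  have "hd q = A" "last r = B" using p ne by (auto simp: AB_paths_iff pqr)
  then have "q \<in> AB_paths \<alpha> \<beta> A (last q) i"
    and r: "r \<in> AB_paths \<alpha> \<beta> (other_step (last q)) B (k - i)"
    using i k ne n last hd by (auto simp: AB_paths_iff bounce_def diff_mult_distrib2)
  moreover have "bounce_free \<alpha> \<beta> q"
    unfolding bounce_free_iff
  proof
    fix m
    show "\<not> bounce \<alpha> \<beta> q m"
    \<comment> \<open>For \<open>m < n\<close> a bounce of \<open>q\<close> would be an earlier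
      bounce of \<open>p\<close>; for \<open>m \<ge> n\<close> the index is not interior to
      \<open>q\<close>.\<close>
    proof (cases "m < n")
      case True
      then show ?thesis using least[OF True] len by (simp add: pqr bounce_append)
    qed (simp add: bounce_def len)
  qed
  ultimately show thesis using that ik pqr by (auto simp: bounce_free_paths_def)
qed

text \<open>Gluing is a bijection from the quadruples \<open>(C, i, q, r)\<close> onto the paths
  with a bounce. The summands for \<open>i = 0\<close> and \<open>i = k\<close> vanish; they are
  kept to match the Cauchy product of power series.\<close>

lemma card_AB_paths_first_bounce:
  assumes "\<alpha> > 0" "coprime \<alpha> \<beta>"
  shows "card (AB_paths \<alpha> \<beta> A B k) = card (bounce_free_paths \<alpha> \<beta> A B k) +
    (\<Sum>C\<in>{E, N}. \<Sum>i=0..k. card (bounce_free_paths \<alpha> \<beta> A C i) *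
       card (AB_paths \<alpha> \<beta> (other_step C) B (k - i)))"
proof -
  let ?F = "bounce_free_paths \<alpha> \<beta>" and ?G = "AB_paths \<alpha> \<beta>"
  define X where "X = (SIGMA C:{E, N}. SIGMA i:{0..k}. ?F A C i \<times> ?G (other_step C) B (k - i))"
  define glue :: "step \<times> nat \<times> step list \<times> step list \<Rightarrow> step list"
    where "glue = (\<lambda>(C, i, q, r). q @ r)"
  \<comment> \<open>If \<open>q\<close> were shorter than \<open>q'\<close>, the bounce at the end
    of \<open>q\<close> would be interior to the bounce-free \<open>q'\<close>. Applied both ways,
    this makes the cut point unique.\<close>
  have shorter: "\<not> length q < length q'"
    if "q \<in> ?G A C i" "r \<in> ?G (other_step C) B j" "q' \<in> ?F A C' i'" "q @ r = q' @ r'"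
    for q r q' r' C C' i i' j
    using bounce_append_AB_paths[OF assms(1) that(1,2)] that(3,4)
      bounce_append[of "length q" q' \<alpha> \<beta> r']
    by (auto simp: bounce_free_paths_def bounce_free_iff)
  have "inj_on glue X"
  proof (rule inj_onI)
    fix x y assume xy: "x \<in> X" "y \<in> X" "glue x = glue y"
    obtain C i q r where x: "x = (C, i, q, r)" by (cases x)
    obtain C' i' q' r' where y: "y = (C', i', q', r')" by (cases y)
    have q: "q \<in> ?F A C i" "q \<in> ?G A C i" "r \<in> ?G (other_step C) B (k - i)"
      and q': "q' \<in> ?F A C' i'" "q' \<in> ?G A C' i'" "r' \<in> ?G (other_step C') B (k - i')"
      and eq: "q @ r = q' @ r'"
      using xy by (auto simp: X_def x y glue_def bounce_free_paths_def)
    have "length q = length q'"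
      using shorter[OF q(2,3) q'(1) eq] shorter[OF q'(2,3) q(1) eq[symmetric]] by linarith
    with eq have "q = q'" "r = r'" by auto
    \<comment> \<open>\<open>C\<close> is the last step of \<open>q\<close>, and \<open>i\<close> is
      read off from its number of East steps, as \<open>\<alpha> > 0\<close>.\<close>
    moreover from this have "C = C'" "\<alpha> * i = \<alpha> * i'" using q(2) q'(2) by (auto simp: AB_paths_iff)
    ultimately show "x = y" using assms(1) by (simp add: x y)
  qed
  moreover have "glue ` X = ?G A B k - ?F A B k"
  proof (intro equalityI subsetI)
    fix p assume "p \<in> glue ` X"
    then obtain C i q r where p: "p = q @ r" "i \<le> k" "q \<in> ?G A C i"
      "r \<in> ?G (other_step C) B (k - i)"
      by (auto simp: X_def glue_def bounce_free_paths_def)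
    then show "p \<in> ?G A B k - ?F A B k"
      using append_AB_paths[OF p(3,4)] bounce_append_AB_paths[OF assms(1) p(3,4)]
      by (auto simp: bounce_free_paths_def bounce_free_iff)
  next
    fix p assume "p \<in> ?G A B k - ?F A B k"
    then have "p \<in> ?G A B k" "\<not> bounce_free \<alpha> \<beta> p" by (auto simp: bounce_free_paths_def)
    then obtain C i q r where *: "i \<le> k" "p = q @ r" "q \<in> ?F A C i"
      "r \<in> ?G (other_step C) B (k - i)"
      by (rule split_at_first_bounce[OF assms])
    then have "(C, i, q, r) \<in> X" by (cases C) (auto simp: X_def)
    then show "p \<in> glue ` X" using *(2) by (force simp: glue_def)
  qed
  ultimately have "card (?G A B k - ?F A B k) = card X" by (metis card_image)
  also have "\<dots> = (\<Sum>C\<in>{E, N}. \<Sum>i=0..k. card (?F A C i) * card (?G (other_step C) B (k - i)))"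
    unfolding X_def
    by (simp add: card_SigmaI card_cartesian_product finite_bounce_free_paths finite_AB_paths)
  moreover have "card (?G A B k) = card (?F A B k) + card (?G A B k - ?F A B k)"
    using card_Diff_subset[OF finite_bounce_free_paths, of \<alpha> \<beta> A B k "?G A B k"]
      card_mono[OF finite_AB_paths, of "?F A B k" \<alpha> \<beta> A B k]
    by (auto simp: bounce_free_paths_def)
  ultimately show ?thesis by simp
qed

lemma path_gf_first_bounce:
  assumes "\<alpha> > 0" "coprime \<alpha> \<beta>"
  shows "path_gf \<alpha> \<beta> A B = bounce_free_gf \<alpha> \<beta> A B
    + bounce_free_gf \<alpha> \<beta> A E * path_gf \<alpha> \<beta> N B + bounce_free_gf \<alpha> \<beta> A N * path_gf \<alpha> \<beta> E B"
  by (rule fps_ext) (simp add: fps_mult_nth card_AB_paths_first_bounce[OF assms, of A B])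

text \<open>The nonzero constant term makes \<open>D\<close> nonzero, so \<open>F * D / D\<close>
  cancels to \<open>F\<close>.\<close>

lemma fps_eq_divide_unit:
  fixes F G D :: "'a :: field fps"
  assumes "F * D = G" "fps_nth D 0 \<noteq> 0"
  shows "F = G / D"
  using assms by (metis fps_nonzero_nth nonzero_mult_div_cancel_right)

theorem theorem2p3:
  fixes \<alpha> \<beta> :: nat
  assumes "\<alpha> > 0" and "\<beta> > 0" and "coprime \<alpha> \<beta>"
  shows "let g = path_gf \<alpha> \<beta>; f = bounce_free_gf \<alpha> \<beta> in
      f E E = g E E / ((1 + g E N)\<^sup>2 - g E E * g N N) \<and>
      f N N = g N N / ((1 + g E N)\<^sup>2 - g E E * g N N) \<and>
      f E N = 1 - (1 + g E N) / ((1 + g E N)\<^sup>2 - g E E * g N N)"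
proof -
  define f g where "f = bounce_free_gf \<alpha> \<beta>" and "g = path_gf \<alpha> \<beta>"
  define D where "D = (1 + g E N)\<^sup>2 - g E E * g N N"
  \<comment> \<open>This turns the determinant
    \<open>(1 + g N E) * (1 + g E N) - g E E * g N N\<close> of the linear system into
    \<open>D\<close>.\<close>
  have sym: "g N E = g E N" using assms by (simp add: g_def path_gf_NE)
  have rec: "g A B = f A B + f A E * g N B + f A N * g E B" for A B
    unfolding f_def g_def using assms by (intro path_gf_first_bounce)
  \<comment> \<open>Every \<open>g A B\<close> has constant term 0, so that of \<open>D\<close> is
    1.\<close>
  have D0: "fps_nth D 0 \<noteq> 0" by (simp add: D_def g_def power2_eq_square)
  \<comment> \<open>The two equations with \<open>A = E\<close> have the unknowns
    \<open>f E E\<close> and \<open>f E N\<close>; eliminating \<open>f E N\<close> leaves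
    this.\<close>
  have "f E E * D = g E E"
    using rec[of E E] rec[of E N] unfolding sym D_def by algebra
  \<comment> \<open>For \<open>A = N\<close> the coefficient matrix is the same, now with the
    unknowns \<open>f N E\<close> and \<open>f N N\<close>.\<close>
  moreover have "f N N * D = g N N"
    using rec[of N E] rec[of N N] unfolding sym D_def by algebra
  \<comment> \<open>Cramer's rule gives
    \<open>f E N * D = g E N * (1 + g E N) - g E E * g N N\<close>; subtracting from
    \<open>D\<close> leaves \<open>1 + g E N\<close>.\<close>
  moreover have "(1 - f E N) * D = 1 + g E N"
    using rec[of E E] rec[of E N] unfolding sym D_def by algebra
  ultimately have "f E E = g E E / D" "f N N = g N N / D" "1 - f E N = (1 + g E N) / D"
    using D0 by (blast intro: fps_eq_divide_unit)+
  then show ?thesis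
    by (simp add: Let_def f_def[symmetric] g_def[symmetric] D_def[symmetric] algebra_simps)
qed

end
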